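(* Let $m\geq 1$ and $n\geq 2$ be integers. Then $$D_n=\left\lfloor\left(\frac{\{e\,(n+2m)!\}}{(n+2m)!}+\sum_{i=1}^{m}\frac{n+2i-1}{(n+2i)!}+e^{-1}\right)n!\right\rfloor .$$
   Context: $D_n$ denotes the number of derangements of $n$ distinct objects (permutations of an $n$-element set with no fixed point). $\lfloor x\rfloor$ denotes the floor of $x$ and $\{x\}=x-\lfloor x\rfloor$ its fractional part. *)

theory Defs
  imports Complex_Main "HOL-Combinatorics.Permutations"
begin

definition derangements :: "'a set \<Rightarrow> ('a \<Rightarrow> 'a) set" where
  "derangements S = {p. p permutes S \<and> (\<forall>x\<in>S. p x \<noteq> x)}"

definition derangement_number :: "nat \<Rightarrow> nat" where
  "derangement_number n = card (derangements {1..n})"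

end

theory Submission
  imports Defs
begin

text \<open>
  Since \<open>(n+2i-1)/(n+2i)! = 1/(n+2i-1)! - 1/(n+2i)!\<close>, the finite sum is an alternating section
  of the exponential series, while the fractional part divided by \<open>(n+2m)!\<close> is the tail of the
  series for \<open>e\<close> beyond \<open>n+2m\<close>. As \<open>D\<^sub>n/n!\<close> is the \<open>n\<close>-th partial sum of the series for \<open>e\<^sup>-\<^sup>1\<close>,
  the bracket equals \<open>D\<^sub>n/n!\<close> plus an error, and Lagrange remainders place \<open>n!\<close> times the
  error in \<open>[0, 1)\<close>. For even \<open>n\<close> the remainder of \<open>e\<^sup>-\<^sup>1\<close> at \<open>n\<close> is negative, but adding the
  finite sum moves it to the remainder at \<open>n+2m\<close>, which the tail of \<open>e\<close> dominates.
\<close>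

lemma finite_derangements: "finite S \<Longrightarrow> finite (derangements S)"
  by (rule finite_subset[OF _ finite_permutations]) (auto simp: derangements_def)

text \<open>Every permutation is a derangement of its support, the set of points that it
  moves.\<close>

lemma permutes_eq_UN_derangements: "{p. p permutes S} = (\<Union>T\<in>Pow S. derangements T)"
proof (intro equalityI subsetI)
  fix p assume "p \<in> {p. p permutes S}"
  then have "p permutes S" by simp
  then have "p permutes {x \<in> S. p x \<noteq> x}"
    by (rule permutes_superset) auto
  then have "p \<in> derangements {x \<in> S. p x \<noteq> x}"
    by (simp add: derangements_def)
  then show "p \<in> (\<Union>T\<in>Pow S. derangements T)"
    by (rule UN_I[rotated]) auto
qed (auto simp: derangements_def intro: permutes_subset)

text \<open>Both sets must be the support of \<open>p\<close>. Hence the union over all subsets is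
  disjoint and cardinalities add.\<close>

lemma derangements_inject:
  assumes "p \<in> derangements S" "p \<in> derangements T"
  shows "S = T"
proof -
  have "U = {x. p x \<noteq> x}" if "p \<in> derangements U" for U
    using that by (auto simp: derangements_def dest: permutes_not_in)
  with assms show ?thesis by blast
qed

lemma fact_card_eq_sum_derangements:
  assumes "finite S"
  shows "fact (card S) = (\<Sum>T\<in>Pow S. card (derangements T))"
proof -
  have "fact (card S) = card (\<Union>T\<in>Pow S. derangements T)"
    by (simp add: card_permutations assms flip: permutes_eq_UN_derangements)
  also have "\<dots> = (\<Sum>T\<in>Pow S. card (derangements T))"
    by (rule card_UN_disjoint)
      (use assms in \<open>auto intro: finite_derangements finite_subset dest: derangements_inject\<close>)
  finally show ?thesis .
qed

text \<open>Moebius inversion over the subset lattice, applied to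
  \<open>fact_card_eq_sum_derangements\<close>; grouping the subsets by size \<open>k\<close> and
  reversing the order of summation gives the alternating series.\<close>

lemma card_derangements:
  assumes "finite S"
  shows "real (card (derangements S)) = fact (card S) * (\<Sum>k\<le>card S. (-1) ^ k / fact k)"
proof -
  let ?n = "card S"
  have "real (card (derangements S)) = (\<Sum>T\<in>Pow S. (-1) ^ (?n - card T) * fact (card T))"
  proof (rule inclusion_exclusion_mobius[where g = "\<lambda>S. fact (card S)", OF _ assms])
    fix U :: "'a set" assume "finite U"
    from fact_card_eq_sum_derangements[OF this]
    have "real (fact (card U)) = real (\<Sum>T\<in>Pow U. card (derangements T))" by (rule arg_cong)
    then show "fact (card U) = (\<Sum>T\<in>Pow U. real (card (derangements T)))" by simp
  qed
  also have "\<dots> = (\<Sum>k\<le>?n. \<Sum>T\<in>{T \<in> Pow S. card T = k}. (-1) ^ (?n - card T) * fact (card T))"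
    by (rule sum.group[symmetric]) (use assms in \<open>auto intro: card_mono\<close>)
  also have "\<dots> = (\<Sum>k\<le>?n. real (?n choose k) * ((-1) ^ (?n - k) * fact k))"
    by (simp add: n_subsets[OF assms])
  also have "\<dots> = (\<Sum>k\<le>?n. fact ?n * ((-1) ^ (?n - k) / fact (?n - k)))"
    by (rule sum.cong) (simp_all add: binomial_fact)
  also have "\<dots> = fact ?n * (\<Sum>k\<le>?n. (-1) ^ (?n - k) / fact (?n - k))"
    by (simp only: sum_distrib_left)
  also have "\<dots> = fact ?n * (\<Sum>k\<le>?n. (-1) ^ k / fact k)"
    using sum.nat_diff_reindex[of "\<lambda>k. (-1) ^ k / fact k :: real" "Suc ?n"]
    by (simp add: lessThan_Suc_atMost)
  finally show ?thesis .
qed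

text \<open>Lagrange remainder with \<open>r = exp t\<close> for some \<open>t\<close> strictly
  between 0 and 1.\<close>

lemma exp_one_remainder:
  obtains r where "exp 1 = (\<Sum>k\<le>N. 1 / fact k) + r / fact (Suc N)" "1 < r" "r < (3::real)"
proof -
  obtain t where t: "0 < t" "t < 1"
    "exp 1 = (\<Sum>k<Suc N. exp 0 / fact k * 1 ^ k) + exp t / fact (Suc N) * (1::real) ^ Suc N"
    using Maclaurin[of 1 "Suc N" "\<lambda>_. exp" exp] by auto
  have "exp t < exp 1" using t(2) by simp
  then have "exp t < 3" using exp_le by linarith
  moreover have "1 < exp t" using t(1) by simp
  moreover have "exp 1 = (\<Sum>k\<le>N. 1 / fact k) + exp t / fact (Suc N)"
    using t(3) unfolding lessThan_Suc_atMost power_one mult_1_right exp_zero .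
  ultimately show ?thesis using that by blast
qed

lemma exp_minus_one_remainder:
  obtains s where "exp (-1) = (\<Sum>k\<le>N. (-1) ^ k / fact k) + (-1) ^ Suc N * s / fact (Suc N)"
    "0 < s" "s < (1::real)"
proof -
  obtain t where t: "t < 0"
    "exp (-1) = (\<Sum>k<Suc N. exp 0 / fact k * (-1) ^ k) + exp t / fact (Suc N) * (-1::real) ^ Suc N"
    using Maclaurin_minus[of "-1" "Suc N" "\<lambda>_. exp" exp] by auto
  have "exp (-1) = (\<Sum>k\<le>N. (-1) ^ k / fact k) + (-1) ^ Suc N * exp t / fact (Suc N)"
    using t(2) unfolding lessThan_Suc_atMost exp_zero by (simp only: mult.commute[of "exp t"] times_divide_eq_left mult_1_left)
  with t(1) show ?thesis using that[of "exp t"] by simp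
qed

lemma fact_mult_sum_inverse_fact_in_Ints:
  "(fact N :: 'a::field_char_0) * (\<Sum>k\<le>N. 1 / fact k) \<in> \<int>"
  unfolding sum_distrib_left
proof (rule Ints_sum)
  fix k assume "k \<in> {..N}"
  then have "k \<le> N" by simp
  then have "fact k dvd (fact N :: nat)" by (rule fact_dvd)
  then obtain c where "(fact N :: nat) = fact k * c" by (rule dvdE)
  then have "(fact N :: 'a) = fact k * of_nat c" by (metis of_nat_fact of_nat_mult)
  then show "(fact N :: 'a) * (1 / fact k) \<in> \<int>" by simp
qed

text \<open>Multiplication by \<open>fact N\<close> makes the partial sum an integer, so only
  \<open>r / Suc N\<close>, which lies in [0, 1), survives in the fractional part.\<close>

lemma frac_exp_one_fact:
  assumes "exp 1 = (\<Sum>k\<le>N. 1 / fact k) + r / fact (Suc N)" "0 \<le> r" "r < real (Suc N)"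
  shows "frac (exp 1 * fact N) / fact N = r / fact (Suc N)"
proof -
  have "exp 1 * fact N = fact N * (\<Sum>k\<le>N. 1 / fact k) + r / real (Suc N)"
    unfolding assms(1) distrib_right by (simp add: mult.commute del: of_nat_Suc)
  then have "frac (exp 1 * fact N) = frac (r / real (Suc N))"
    by (simp only: frac_add_int_left fact_mult_sum_inverse_fact_in_Ints)
  also have "\<dots> = r / real (Suc N)"
    using assms(2,3) by (intro frac_eq_id) (simp add: divide_simps)
  finally show ?thesis by simp
qed

lemma sum_eq_alternating_section:
  "(\<Sum>i = 1..m. real (n + 2 * i - 1) / fact (n + 2 * i)) =
    (-1) ^ Suc n * ((\<Sum>k\<le>n + 2 * m. (-1) ^ k / fact k) - (\<Sum>k\<le>n. (-1) ^ k / fact k))"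
proof (induction m)
  case (Suc m)
  define N where "N = n + 2 * m"
  have "real (Suc N) / fact (Suc (Suc N)) = 1 / fact (Suc N) - 1 / fact (Suc (Suc N))"
  proof -
    have "real (Suc N) / fact (Suc (Suc N)) = (real (Suc (Suc N)) - 1) / fact (Suc (Suc N))"
      by simp
    then show ?thesis
      unfolding diff_divide_distrib fact_Suc[of "Suc N"] by (simp del: fact_Suc of_nat_Suc)
  qed
  \<comment> \<open>The step from \<open>m\<close> to \<open>Suc m\<close> adds two terms of the
    series; as \<open>N\<close> and \<open>n\<close> have the same parity, their signs depend on
    \<open>n\<close> only.\<close>
  moreover have "(-1) ^ N = ((-1) ^ n :: real)"
    by (simp add: N_def power_add)
  then have "(\<Sum>k\<le>Suc (Suc N). (-1) ^ k / fact k :: real) =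
      (\<Sum>k\<le>N. (-1) ^ k / fact k) - (-1) ^ n * (1 / fact (Suc N) - 1 / fact (Suc (Suc N)))"
    by (simp add: algebra_simps del: fact_Suc)
  moreover have "n + 2 * Suc m = Suc (Suc N)" by (simp add: N_def)
  moreover have "real n + 2 * real m = real N" by (simp add: N_def)
  moreover have "(-1) ^ n * ((-1) ^ n * x) = x" for x :: real
    by (simp flip: mult.assoc power_add)
  ultimately show ?case
    using Suc by (simp add: right_diff_distrib del: fact_Suc sum.atMost_Suc mult_Suc_right flip: N_def)
qed simp

theorem theorem7:
  fixes m n :: nat
  assumes "m \<ge> 1" and "n \<ge> 2"
  shows "int (derangement_number n) =
    \<lfloor>(frac (exp 1 * fact (n + 2 * m)) / fact (n + 2 * m)
      + (\<Sum>i = 1..m. real (n + 2 * i - 1) / fact (n + 2 * i))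
      + inverse (exp 1)) * (fact n :: real)\<rfloor>"
proof -
  define N where "N = n + 2 * m"
  define P where "P = (\<lambda>K. \<Sum>k\<le>K. (-1) ^ k / fact k :: real)"
  define S where "S = (\<Sum>i = 1..m. real (n + 2 * i - 1) / fact (n + 2 * i))"
  obtain r where r: "exp 1 = (\<Sum>k\<le>N. 1 / fact k) + r / fact (Suc N)" "1 < r" "r < (3::real)"
    by (rule exp_one_remainder)
  obtain s where s: "exp (-1) = P n + (-1) ^ Suc n * s / fact (Suc n)" "0 < s" "s < 1"
    unfolding P_def by (rule exp_minus_one_remainder)
  obtain s' where s': "exp (-1) = P N + (-1) ^ Suc N * s' / fact (Suc N)" "0 < s'" "s' < 1"
    unfolding P_def by (rule exp_minus_one_remainder)
  \<comment> \<open>Here \<open>r < 3 < Suc N\<close>, because \<open>N\<close> is at least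
    4.\<close>
  have T: "frac (exp 1 * fact N) / fact N = r / fact (Suc N)"
    using r assms by (intro frac_exp_one_fact) (auto simp: N_def)
  have S: "S = (-1) ^ Suc n * (P N - P n)"
    unfolding S_def P_def N_def by (rule sum_eq_alternating_section)
  have parity: "even N \<longleftrightarrow> even n" by (simp add: N_def)
  \<comment> \<open>The error times \<open>fact n\<close> is \<open>d + c\<close>: \<open>d\<close>
    compares the remainders of \<open>exp 1\<close> and \<open>exp (-1)\<close> at \<open>N\<close>,
    and \<open>c\<close> appears for odd \<open>n\<close> only.\<close>
  define d where "d = (r - s') * fact n / fact (Suc N)"
  define c where "c = (if even n then 0 else 2 * s / real (Suc n))"
  have "(r / fact (Suc N) + S + exp (-1)) * fact n = fact n * P n + (d + c)"
  proof (cases "even n")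
    case True
    \<comment> \<open>Now \<open>S = P n - P N\<close>, so the expansion of \<open>exp (-1)\<close>
      at \<open>N\<close> suffices.\<close>
    then have "r / fact (Suc N) + S + exp (-1) = P n + (r - s') / fact (Suc N)"
      using s'(1) parity by (simp add: S diff_divide_distrib del: fact_Suc)
    then show ?thesis
      using True by (simp add: d_def c_def algebra_simps del: fact_Suc)
  next
    case False
    \<comment> \<open>Now \<open>S = P N - P n\<close>. Replacing \<open>P N\<close> by its
      expansion leaves \<open>2 * exp (-1) - P n\<close>, whence the factor 2 on the remainder at
      \<open>n\<close>.\<close>
    then have "r / fact (Suc N) + S + exp (-1) = P n + (r - s') / fact (Suc N) + 2 * s / fact (Suc n)"
      using s(1) s'(1) parity by (simp add: S diff_divide_distrib del: fact_Suc)
    moreover have "2 * s / fact (Suc n) * fact n = c"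
      using False by (simp add: c_def)
    ultimately show ?thesis
      by (simp add: d_def algebra_simps del: fact_Suc)
  qed
  moreover have "fact n * P n = real (derangement_number n)"
    by (simp add: derangement_number_def card_derangements P_def)
  ultimately have eq: "(frac (exp 1 * fact N) / fact N + S + inverse (exp 1)) * fact n =
      real (derangement_number n) + (d + c)"
    by (simp only: T exp_minus)
  \<comment> \<open>This rests on \<open>s' < 1 < r\<close>.\<close>
  have "0 \<le> d" using r s' by (simp add: d_def)
  moreover have "0 \<le> c" using s by (simp add: c_def)
  moreover have "d + c < 1"
  proof -
    have "(fact (n + 2) :: real) \<le> fact (Suc N)"
      using assms by (intro fact_mono) (simp add: N_def)
    moreover have "(fact (n + 2) :: real) = real (n + 2) * (real (n + 1) * fact n)" by simp
    \<comment> \<open>The constant is 4 * 3, from \<open>n \<ge> 2\<close>; with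
      \<open>r - s' < 3\<close> it yields \<open>d \<le> 3 / 12\<close>.\<close>
    moreover have "12 \<le> real (n + 2) * real (n + 1)"
      using mult_mono[of 4 "real (n + 2)" 3 "real (n + 1)"] assms by simp
    then have "12 * fact n \<le> real (n + 2) * real (n + 1) * (fact n :: real)"
      by (rule mult_right_mono) simp
    ultimately have "12 * (fact n :: real) \<le> fact (Suc N)" by (simp only: mult.assoc)
    moreover have "(r - s') * fact n \<le> 3 * fact n"
      using r s' by (intro mult_right_mono) auto
    ultimately have "(r - s') * fact n * 4 \<le> fact (Suc N)" by linarith
    then have "d \<le> 1 / 4"
      by (simp add: d_def field_simps del: fact_Suc)
    moreover have "c \<le> 1 / 2"
    proof (cases "even n")
      case False
      \<comment> \<open>An odd \<open>n \<ge> 2\<close> is at least 3.\<close>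
      with assms have "4 \<le> Suc n" by presburger
      then have "4 \<le> real (Suc n)" by linarith
      with False s show ?thesis by (simp add: c_def field_simps)
    qed (simp add: c_def)
    ultimately show ?thesis by linarith
  qed
  ultimately show ?thesis
    using eq unfolding N_def S_def by (intro floor_unique[symmetric]) auto
qed

end
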